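(* Let $n\ge 1$, $m\ge 0$ and $0\le k\le n$ be integers, and put $e=n-(mk+m-1)$. The number $w_{\ge k}(n,m)$ of $n$-strings containing exactly $m$ runs of ones of length at least $k$ is $$w_{\ge k}(n,m)=\sum_{t=0}^{\lfloor e/(k+1)\rfloor}(-1)^t\,2^{e-(k+1)t}\left(\binom{m+e-kt}{e-kt}\binom{e-kt}{e-(k+1)t}-\frac12\binom{m+e-1-kt}{e-1-kt}\binom{e-1-kt}{e-1-(k+1)t}\right).$$
   Context: An $n$-string is a binary string of length $n$. A run of ones is a maximal block of consecutive ones, flanked on each side by a zero or by the start/end of the string. Null runs (length $0$) of ones also count when $k=0$: there is one between every two consecutive zeros, one before an initial zero and one after a final zero; thus a string with $z$ zeros has exactly $z+1$ runs of ones (including null ones). Runs shorter than $k$ are unrestricted. Binomial coefficients: $\binom{a}{b}$ is the usual one for integers $a\ge b\ge 0$, and $\binom{a}{b}=0$ if $b<0$ or $a<b$. A sum whose upper limit is smaller than its lower limit is $0$. *)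

theory Defs
  imports Complex_Main
begin

text \<open>
  A binary string is a \<open>bool list\<close>, with \<open>True\<close> for one and \<open>False\<close> for zero.
  A run of ones is given by its boundaries \<open>(i, j)\<close>: it occupies the positions
  \<open>i, \<dots>, j - 1\<close>. The case \<open>i = j\<close> is a null run, sitting in the gap before position \<open>i\<close>;
  the flanking conditions then put it between two consecutive zeros, before an initial zero
  or after a final zero.
\<close>

definition runs_of_ones :: "bool list \<Rightarrow> (nat \<times> nat) set" where
  "runs_of_ones xs = {(i, j). i \<le> j \<and> j \<le> length xs \<and>
     (\<forall>p. i \<le> p \<and> p < j \<longrightarrow> xs ! p) \<and>
     (i = 0 \<or> \<not> xs ! (i - 1)) \<and>
     (j = length xs \<or> \<not> xs ! j)}"

definition num_runs_ge :: "nat \<Rightarrow> bool list \<Rightarrow> nat" where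
  "num_runs_ge k xs = card {(i, j) \<in> runs_of_ones xs. j - i \<ge> k}"

definition w_ge :: "nat \<Rightarrow> nat \<Rightarrow> nat \<Rightarrow> nat" where
  "w_ge k n m = card {xs :: bool list. length xs = n \<and> num_runs_ge k xs = m}"

text \<open>
  Unlike \<open>gbinomial\<close>, this vanishes for every negative upper argument.
\<close>

definition int_binomial :: "int \<Rightarrow> int \<Rightarrow> nat" where
  "int_binomial a b = (if 0 \<le> b \<and> b \<le> a then nat a choose nat b else 0)"

end

theory Submission
  imports Defs "HOL-Computational_Algebra.Formal_Power_Series"
begin

text \<open>
  Append a zero to every string. A string of length \<open>n\<close> then becomes a sequence of blocks
  \<open>1\<^sup>a0\<close> of total length \<open>n + 1\<close>, one block for each run of ones, null runs included; so the runs
  are independent of each other. With \<open>X\<close> marking the length and \<open>y\<close> the runs of length at least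
  \<open>k\<close>, a block is counted by \<open>B = (X - X^(k+1) + y X^(k+1)) / (1 - X)\<close> and all strings by
  \<open>1 / (1 - B) = (1 - X) / (P - y X^(k+1))\<close>, where \<open>P = 1 - 2 X + X^(k+1)\<close>. The coefficient of
  \<open>y^m\<close> is \<open>X^(m(k+1)) (1 - X) / P^(m+1)\<close>. Hence \<open>w_ge k n m = c e - c (e - 1)\<close>, where \<open>c e\<close> is
  the coefficient of \<open>X^e\<close> in \<open>1 / P^(m+1)\<close> and \<open>e = n + 1 - m (k + 1)\<close>; the two terms of the
  summand, of which the second carries the factor \<open>1/2\<close>, come from expanding \<open>c e\<close> and
  \<open>c (e - 1)\<close> by the binomial theorem.

  Below, the expansion in \<open>y\<close> is an induction on \<open>m\<close>: \<open>w_ge_first_block\<close> splits off the first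
  block, \<open>run_gf_rec\<close> turns this into a recurrence in \<open>m\<close> for univariate power series,
  \<open>run_gf_closed\<close> solves it, and \<open>nth_inverse_block_poly_power\<close> computes \<open>c\<close>.
\<close>

section \<open>Splitting off the first run\<close>

lemma runs_of_ones_replicate: "runs_of_ones (replicate n True) = {(0, n)}"
proof -
  have "(i, j) \<in> runs_of_ones (replicate n True) \<longleftrightarrow> i = 0 \<and> j = n" for i j
    unfolding runs_of_ones_def by (cases i) (auto, metis le_neq_implies_less nth_replicate)
  then show ?thesis
    by auto
qed

lemma runs_of_ones_block:
  "runs_of_ones (replicate a True @ False # ys) =
     insert (0, a) ((\<lambda>(i, j). (Suc a + i, Suc a + j)) ` runs_of_ones ys)"
  (is "runs_of_ones ?zs = ?R")
proof -
  have lt: "?zs ! p" if "p < a" for p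
    using that by (simp add: nth_append)
  have eq: "\<not> ?zs ! a"
    by (simp add: nth_append)
  have gt: "?zs ! (Suc a + p) = ys ! p" for p
    by (simp add: nth_append)
  have len: "length ?zs = Suc a + length ys"
    by simp
  have shift: "(Suc a + i, Suc a + j) \<in> runs_of_ones ?zs \<longleftrightarrow> (i, j) \<in> runs_of_ones ys" for i j
  proof -
    have 1: "(\<forall>p. Suc a + i \<le> p \<and> p < Suc a + j \<longrightarrow> ?zs ! p) \<longleftrightarrow>
        (\<forall>p. i \<le> p \<and> p < j \<longrightarrow> ys ! p)" (is "?l \<longleftrightarrow> ?r")
    proof
      assume ?l
      then show ?r
        by (metis add_le_cancel_left gt nat_add_left_cancel_less)
    next
      assume r: ?r
      show ?l
      proof (intro allI impI)
        fix p
        assume p: "Suc a + i \<le> p \<and> p < Suc a + j"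
        then obtain q where "p = Suc a + q"
          using le_Suc_ex by (metis add.assoc)
        with p r gt show "?zs ! p"
          by (metis add_le_cancel_left nat_add_left_cancel_less)
      qed
    qed
    have 2: "(Suc a + i = 0 \<or> \<not> ?zs ! (Suc a + i - 1)) \<longleftrightarrow> (i = 0 \<or> \<not> ys ! (i - 1))"
    proof (cases i)
      case 0
      then show ?thesis
        using eq by simp
    next
      case (Suc i')
      then show ?thesis
        using gt[of i'] by simp
    qed
    show ?thesis
      unfolding runs_of_ones_def mem_Collect_eq case_prod_conv 1 2 gt len by simp
  qed
  have first: "(i, j) \<in> runs_of_ones ?zs \<longleftrightarrow> i = 0 \<and> j = a" if "i \<le> a" for i j
  proof
    assume ij: "(i, j) \<in> runs_of_ones ?zs"
    then have "i = 0 \<or> \<not> ?zs ! (i - 1)" and ones: "\<forall>p. i \<le> p \<and> p < j \<longrightarrow> ?zs ! p"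
      and j: "j = length ?zs \<or> \<not> ?zs ! j"
      unfolding runs_of_ones_def by blast+
    then have "i = 0"
      using lt[of "i - 1"] that by (cases i) auto
    moreover have "j \<le> a"
      using ones that eq not_le by blast
    moreover have "\<not> j < a"
      using j lt len by auto
    ultimately show "i = 0 \<and> j = a"
      by simp
  next
    assume "i = 0 \<and> j = a"
    then show "(i, j) \<in> runs_of_ones ?zs"
      unfolding runs_of_ones_def using lt eq by auto
  qed
  show ?thesis
  proof (rule set_eqI, clarify)
    fix i j
    show "(i, j) \<in> runs_of_ones ?zs \<longleftrightarrow> (i, j) \<in> ?R"
    proof (cases "i \<le> a")
      case True
      then show ?thesis
        using first[OF True] by auto
    next
      case False
      then obtain i' where i: "i = Suc a + i'"
        by (metis le_Suc_ex not_less_eq_eq)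
      show ?thesis
      proof (cases "i \<le> j")
        case True
        then obtain j' where j: "j = Suc a + j'"
          using i by (metis le_Suc_ex add.assoc)
        show ?thesis
          unfolding i j shift by auto
      next
        case False
        then have "(i, j) \<notin> runs_of_ones ?zs"
          by (simp add: runs_of_ones_def)
        moreover have "(i, j) \<notin> ?R"
          using False i by (auto simp: runs_of_ones_def)
        ultimately show ?thesis
          by simp
      qed
    qed
  qed
qed

lemma finite_runs_of_ones: "finite (runs_of_ones xs)"
  by (rule finite_subset[of _ "{..length xs} \<times> {..length xs}"]) (auto simp: runs_of_ones_def)

lemma num_runs_ge_replicate: "num_runs_ge k (replicate n True) = of_bool (k \<le> n)"
proof -
  have "{(i, j) \<in> runs_of_ones (replicate n True). j - i \<ge> k} = (if k \<le> n then {(0, n)} else {})"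
    unfolding runs_of_ones_replicate by auto
  then show ?thesis
    unfolding num_runs_ge_def by simp
qed

lemma num_runs_ge_block:
  "num_runs_ge k (replicate a True @ False # ys) = of_bool (k \<le> a) + num_runs_ge k ys"
proof -
  let ?f = "\<lambda>(i, j). (Suc a + i, Suc a + j)"
  let ?S = "{(i, j) \<in> runs_of_ones ys. j - i \<ge> k}"
  have "{(i, j) \<in> runs_of_ones (replicate a True @ False # ys). j - i \<ge> k} =
      (if k \<le> a then {(0, a)} else {}) \<union> ?f ` ?S"
    unfolding runs_of_ones_block by auto
  moreover have "finite ?S"
    by (rule finite_subset[OF _ finite_runs_of_ones[of ys]]) auto
  then have "card ((if k \<le> a then {(0, a)} else {}) \<union> ?f ` ?S) =
      card (if k \<le> a then {(0 :: nat, a)} else {}) + card (?f ` ?S)"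
    by (intro card_Un_disjoint) auto
  moreover have "card (?f ` ?S) = card ?S"
    by (rule card_image) (auto simp: inj_on_def)
  ultimately show ?thesis
    unfolding num_runs_ge_def by simp
qed

lemma first_block_cases:
  fixes xs :: "bool list"
  obtains "xs = replicate (length xs) True"
  | a ys where "xs = replicate a True @ False # ys"
proof (cases "False \<in> set xs")
  case True
  then obtain us ys where xs: "xs = us @ False # ys" and us: "False \<notin> set us"
    by (meson split_list_first)
  from us have "us = replicate (length us) True"
    by (intro replicate_length_same[symmetric]) (metis (full_types))
  with xs show ?thesis
    using that(2)[of "length us" ys] by simp
next
  case False
  then have "xs = replicate (length xs) True"
    by (intro replicate_length_same[symmetric]) (metis (full_types))
  then show ?thesis
    by (rule that(1))
qed

lemma block_eq_iff:
  "replicate a True @ False # ys = replicate b True @ False # zs \<longleftrightarrow> a = b \<and> ys = zs"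
proof (induction a arbitrary: b)
  case 0
  then show ?case
    by (cases b) auto
next
  case (Suc a)
  then show ?case
    by (cases b) auto
qed

text \<open>
  The last summand is the string without zeros, whose only block is closed by the appended zero.
\<close>

lemma w_ge_first_block:
  "w_ge k n m =
     (\<Sum>a<n. card {ys. length ys = n - 1 - a \<and> of_bool (k \<le> a) + num_runs_ge k ys = m}) +
     of_bool (m = of_bool (k \<le> n))"
proof -
  define Y where
    "Y a = {ys. length ys = n - 1 - a \<and> of_bool (k \<le> a) + num_runs_ge k ys = m}" for a
  define Z where "Z a = (\<lambda>ys. replicate a True @ False # ys) ` Y a" for a
  define R where "R = (if m = of_bool (k \<le> n) then {replicate n True} else {})"
  have finY: "finite (Y a)" for a
    by (rule finite_subset[OF _ finite_lists_length_eq[of UNIV "n - 1 - a"]]) (auto simp: Y_def)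
  have split: "{xs. length xs = n \<and> num_runs_ge k xs = m} = (\<Union>a<n. Z a) \<union> R"
  proof (intro equalityI subsetI)
    fix xs :: "bool list"
    assume xs: "xs \<in> {xs. length xs = n \<and> num_runs_ge k xs = m}"
    show "xs \<in> (\<Union>a<n. Z a) \<union> R"
    proof (cases xs rule: first_block_cases)
      case 1
      then have "xs = replicate n True"
        using xs by simp
      then show ?thesis
        using xs by (auto simp: R_def num_runs_ge_replicate)
    next
      case (2 a ys)
      then have "ys \<in> Y a" "a < n"
        using xs by (auto simp: Y_def num_runs_ge_block)
      then show ?thesis
        using 2 by (auto simp: Z_def)
    qed
  next
    fix xs
    assume "xs \<in> (\<Union>a<n. Z a) \<union> R"
    then show "xs \<in> {xs. length xs = n \<and> num_runs_ge k xs = m}"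
      by (auto simp: Z_def Y_def R_def num_runs_ge_block num_runs_ge_replicate split: if_splits)
  qed
  have "replicate n True \<notin> Z a" for a
  proof
    assume "replicate n True \<in> Z a"
    then obtain ys where "replicate n True = replicate a True @ False # ys"
      by (auto simp: Z_def)
    then have "False \<in> set (replicate n True)"
      by (metis in_set_conv_decomp)
    then show False
      by simp
  qed
  then have "card ((\<Union>a<n. Z a) \<union> R) = card (\<Union>a<n. Z a) + card R"
    by (intro card_Un_disjoint) (auto simp: R_def Z_def finY)
  also have "card (\<Union>a<n. Z a) = (\<Sum>a<n. card (Z a))"
    by (rule card_UN_disjoint) (auto simp: Z_def finY block_eq_iff)
  also have "\<dots> = (\<Sum>a<n. card (Y a))"
    by (intro sum.cong refl) (auto simp: Z_def inj_on_def intro!: card_image)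
  also have "card R = of_bool (m = of_bool (k \<le> n))"
    by (simp add: R_def)
  finally show ?thesis
    unfolding w_ge_def split Y_def .
qed

unbundle fps_syntax

section \<open>The generating function\<close>

text \<open>
  The exponent is the length after appending a zero, hence the shift by one; the constant term
  stands for the empty sequence of blocks, which is no string and contains no run.
\<close>

definition run_gf :: "nat \<Rightarrow> nat \<Rightarrow> real fps" where
  "run_gf k m = Abs_fps (\<lambda>N. case N of 0 \<Rightarrow> of_bool (m = 0) | Suc n \<Rightarrow> real (w_ge k n m))"

definition short_blocks :: "nat \<Rightarrow> real fps" where
  "short_blocks k = Abs_fps (\<lambda>N. of_bool (1 \<le> N \<and> N \<le> k))"

definition long_blocks :: "nat \<Rightarrow> real fps" where
  "long_blocks k = Abs_fps (\<lambda>N. of_bool (k < N))"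

definition block_poly :: "nat \<Rightarrow> real fps" where
  "block_poly k = 1 - 2 * fps_X + fps_X ^ (k + 1)"

lemma one_minus_X_times_short: "(1 - fps_X) * short_blocks k = fps_X - fps_X ^ (k + 1)"
proof (rule fps_ext)
  fix N
  show "((1 - fps_X) * short_blocks k) $ N = (fps_X - fps_X ^ (k + 1)) $ N"
    by (cases N) (auto simp: left_diff_distrib short_blocks_def fps_X_power_nth fps_X_nth simp del: power_Suc)
qed

lemma one_minus_X_times_long: "(1 - fps_X) * long_blocks k = fps_X ^ (k + 1)"
proof (rule fps_ext)
  fix N
  show "((1 - fps_X) * long_blocks k) $ N = fps_X ^ (k + 1) $ N"
    by (cases N) (auto simp: left_diff_distrib long_blocks_def fps_X_power_nth simp del: power_Suc)
qed

lemma run_gf_split: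
  "run_gf k m = of_bool (m = 0) + short_blocks k * run_gf k m +
     long_blocks k * (if m = 0 then 0 else run_gf k (m - 1))"
proof (rule fps_ext)
  fix N
  define g' where "g' = (if m = 0 then 0 else run_gf k (m - 1))"
  have bool0: "(of_bool b :: real fps) $ N = of_bool (b \<and> N = 0)" for b
    by simp
  show "run_gf k m $ N = (of_bool (m = 0) + short_blocks k * run_gf k m +
      long_blocks k * (if m = 0 then 0 else run_gf k (m - 1))) $ N"
  proof (cases N)
    case 0
    then show ?thesis
      by (simp add: run_gf_def short_blocks_def long_blocks_def)
  next
    case (Suc n)
    have conv: "(short_blocks k * run_gf k m + long_blocks k * g') $ Suc n =
        (\<Sum>a\<le>n. if k \<le> a then g' $ (n - a) else run_gf k m $ (n - a))"
    proof -
      have "(short_blocks k * run_gf k m + long_blocks k * g') $ Suc n =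
          (\<Sum>i = 0..Suc n. short_blocks k $ i * run_gf k m $ (Suc n - i) +
             long_blocks k $ i * g' $ (Suc n - i))"
        by (simp only: fps_add_nth fps_mult_nth sum.distrib)
      also have "\<dots> = (\<Sum>a = 0..n. short_blocks k $ Suc a * run_gf k m $ (n - a) +
             long_blocks k $ Suc a * g' $ (n - a))"
        by (subst sum.atLeast0_atMost_Suc_shift)
           (simp add: short_blocks_def long_blocks_def)
      also have "\<dots> = (\<Sum>a\<le>n. if k \<le> a then g' $ (n - a) else run_gf k m $ (n - a))"
        unfolding atMost_atLeast0
        by (intro sum.cong refl) (auto simp: short_blocks_def long_blocks_def)
      finally show ?thesis .
    qed
    have strings: "real (card {ys. length ys = n - 1 - a \<and> of_bool (k \<le> a) + num_runs_ge k ys = m}) =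
        (if k \<le> a then g' $ (n - a) else run_gf k m $ (n - a))" if "a < n" for a
    proof -
      have "n - a = Suc (n - 1 - a)"
        using that by simp
      then have coeff: "run_gf k l $ (n - a) = real (w_ge k (n - 1 - a) l)" for l
        by (simp only: run_gf_def fps_nth_Abs_fps nat.case)
      show ?thesis
      proof (cases m)
        case 0
        then show ?thesis
          unfolding g'_def coeff by (cases "k \<le> a") (simp_all add: w_ge_def)
      next
        case (Suc l)
        then show ?thesis
          unfolding g'_def by (cases "k \<le> a") (simp_all add: coeff w_ge_def)
      qed
    qed
    have all_ones: "of_bool (m = of_bool (k \<le> n)) =
        (if k \<le> n then g' $ (n - n) else run_gf k m $ (n - n))"
      by (cases m) (auto simp: g'_def run_gf_def)
    have "run_gf k m $ Suc n = real (w_ge k n m)"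
      by (simp add: run_gf_def)
    also have "\<dots> = (\<Sum>a<n. if k \<le> a then g' $ (n - a) else run_gf k m $ (n - a)) +
        (if k \<le> n then g' $ (n - n) else run_gf k m $ (n - n))"
      unfolding w_ge_first_block of_nat_add of_nat_sum of_nat_of_bool all_ones
      by (intro arg_cong2[of _ _ _ _ "(+)"] sum.cong refl strings) simp
    also have "\<dots> = (\<Sum>a\<le>n. if k \<le> a then g' $ (n - a) else run_gf k m $ (n - a))"
      by (simp add: lessThan_Suc_atMost[symmetric])
    also have "\<dots> = (short_blocks k * run_gf k m + long_blocks k * g') $ N"
      unfolding Suc conv ..
    also have "\<dots> = (of_bool (m = 0) + short_blocks k * run_gf k m + long_blocks k * g') $ N"
      unfolding fps_add_nth bool0 using Suc by simp
    finally show ?thesis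
      unfolding Suc g'_def .
  qed
qed

text \<open>
  Multiplication by \<open>1 - X\<close> turns the two block series, which are geometric, into polynomials.
\<close>

lemma run_gf_rec:
  "block_poly k * run_gf k m =
     of_bool (m = 0) * (1 - fps_X) + fps_X ^ (k + 1) * (if m = 0 then 0 else run_gf k (m - 1))"
proof -
  define g g' where "g = run_gf k m" and "g' = (if m = 0 then 0 else run_gf k (m - 1))"
  have "g = of_bool (m = 0) + short_blocks k * g + long_blocks k * g'"
    unfolding g_def g'_def by (rule run_gf_split)
  then have "(1 - fps_X) * g =
      (1 - fps_X) * (of_bool (m = 0) + short_blocks k * g + long_blocks k * g')"
    by simp
  also have "\<dots> = of_bool (m = 0) * (1 - fps_X) + ((1 - fps_X) * short_blocks k) * g +
      ((1 - fps_X) * long_blocks k) * g'"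
    by (simp only: algebra_simps)
  also have "\<dots> = of_bool (m = 0) * (1 - fps_X) + (fps_X - fps_X ^ (k + 1)) * g +
      fps_X ^ (k + 1) * g'"
    by (simp only: one_minus_X_times_short one_minus_X_times_long)
  finally have eq: "(1 - fps_X) * g = \<dots>" .
  have cancel: "a + b + c - b = a + c" for a b c :: "real fps"
    by simp
  have "block_poly k * g = (1 - fps_X) * g - (fps_X - fps_X ^ (k + 1)) * g"
    unfolding block_poly_def by (simp add: algebra_simps)
  also have "\<dots> = of_bool (m = 0) * (1 - fps_X) + fps_X ^ (k + 1) * g'"
    unfolding eq by (rule cancel)
  finally show ?thesis
    unfolding g_def g'_def .
qed

lemma run_gf_times_block_poly_power:
  "block_poly k ^ (m + 1) * run_gf k m = fps_X ^ ((k + 1) * m) * (1 - fps_X)"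
proof (induction m)
  case 0
  then show ?case
    using run_gf_rec[of k 0] by simp
next
  case (Suc m)
  have "block_poly k ^ (Suc m + 1) * run_gf k (Suc m) =
      block_poly k ^ (m + 1) * (block_poly k * run_gf k (Suc m))"
    by (simp add: mult_ac)
  also have "block_poly k * run_gf k (Suc m) = fps_X ^ (k + 1) * run_gf k m"
    using run_gf_rec[of k "Suc m"] by simp
  also have "block_poly k ^ (m + 1) * \<dots> =
      fps_X ^ (k + 1) * (block_poly k ^ (m + 1) * run_gf k m)"
    by (simp only: mult_ac)
  also have "\<dots> = fps_X ^ ((k + 1) * Suc m) * (1 - fps_X)"
    unfolding Suc.IH mult_Suc_right power_add[of fps_X "k + 1"] by (simp only: mult.assoc)
  finally show ?case .
qed

lemma block_poly_eq: "block_poly k = 1 - fps_X * (2 - fps_X ^ k)"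
  by (simp add: block_poly_def algebra_simps)

lemma run_gf_closed:
  "run_gf k m = fps_X ^ ((k + 1) * m) * ((1 - fps_X) * inverse (block_poly k ^ (m + 1)))"
proof -
  have "inverse (block_poly k ^ (m + 1)) * block_poly k ^ (m + 1) = 1"
    by (intro inverse_mult_eq_1) (simp add: fps_power_zeroth block_poly_eq)
  then have "run_gf k m =
      inverse (block_poly k ^ (m + 1)) * (block_poly k ^ (m + 1) * run_gf k m)"
    by (simp only: mult.assoc[symmetric] mult_1_left)
  also have "\<dots> = inverse (block_poly k ^ (m + 1)) * (fps_X ^ ((k + 1) * m) * (1 - fps_X))"
    by (simp only: run_gf_times_block_poly_power)
  finally show ?thesis
    by (simp only: mult_ac)
qed

section \<open>Coefficients\<close>

text \<open>
  With \<open>Y = X (2 - X^k)\<close> the series is \<open>1 / (1 - Y)^(m+1)\<close>. The power \<open>Y^j\<close> contributes to the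
  coefficient of \<open>X^E\<close> through those \<open>t\<close> with \<open>j + k t = E\<close>, where \<open>t\<close> is the number of factors
  \<open>- X^k\<close> chosen, so that \<open>j = E - k t\<close>. The upper limit \<open>T\<close> is left free in order that the
  coefficients of \<open>X^E\<close> and \<open>X^(E-1)\<close> can be summed over the same range.
\<close>

lemma nth_inverse_block_poly_power:
  assumes "E div (k + 1) \<le> T"
  shows "inverse (block_poly k ^ (m + 1)) $ E =
    (\<Sum>t\<le>T. if (k + 1) * t \<le> E
      then (- 1) ^ t * 2 ^ (E - (k + 1) * t) *
        (real (m + (E - k * t) choose (E - k * t)) *
         real (E - k * t choose (E - (k + 1) * t)))
      else 0)"
proof -
  define Y :: "real fps" where "Y = fps_X * (2 - fps_X ^ k)"
  have Y0: "Y $ 0 = 0"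
    by (simp add: Y_def)
  have "block_poly k ^ (m + 1) = (1 - fps_X) ^ (m + 1) oo Y"
    unfolding fps_compose_power[OF Y0, symmetric] fps_compose_sub_distrib fps_compose_1
      fps_X_fps_compose_startby0[OF Y0] by (simp only: block_poly_eq Y_def)
  then have "inverse (block_poly k ^ (m + 1)) = inverse ((1 - fps_X) ^ (m + 1)) oo Y"
    using fps_inverse_compose[OF Y0, of "(1 - fps_X) ^ (m + 1)"] by (simp add: fps_power_zeroth)
  also have "inverse ((1 - fps_X :: real fps) ^ (m + 1)) =
      Abs_fps (\<lambda>j. real (m + j choose j))"
    using one_minus_const_fps_X_neg_power'[of "m + 1" "1 :: real"]
    by (simp add: binomial_symmetric[of m] del: power_Suc)
  finally have "inverse (block_poly k ^ (m + 1)) $ E =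
      (\<Sum>j\<le>E. real (m + j choose j) * (Y ^ j) $ E)"
    by (simp add: fps_compose_nth atMost_atLeast0)
  also have "\<dots> = (\<Sum>j\<le>E. \<Sum>t\<le>j. if j + k * t = E
      then real (m + j choose j) * (real (j choose t) * (- 1) ^ t * 2 ^ (j - t)) else 0)"
  proof (intro sum.cong refl)
    fix j
    have "Y ^ j = fps_X ^ j * (- (fps_X ^ k) + 2) ^ j"
      by (simp add: Y_def power_mult_distrib)
    also have "\<dots> = (\<Sum>t\<le>j. fps_X ^ j * (of_nat (j choose t) * (- (fps_X ^ k)) ^ t * 2 ^ (j - t)))"
      by (simp only: binomial_ring sum_distrib_left)
    also have "\<dots> = (\<Sum>t\<le>j. fps_const (real (j choose t) * (- 1) ^ t * 2 ^ (j - t)) *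
        fps_X ^ (j + k * t))"
    proof (intro sum.cong refl)
      fix t
      have "(- (fps_X ^ k)) ^ t = fps_const ((- 1 :: real) ^ t) * fps_X ^ (k * t)"
        by (subst power_minus)
           (simp add: power_mult fps_const_power[symmetric] fps_const_neg[symmetric] del: fps_const_power fps_const_neg)
      moreover have "(2 :: real fps) ^ (j - t) = fps_const (2 ^ (j - t))"
        by (simp add: numeral_fps_const)
      ultimately show "fps_X ^ j * (of_nat (j choose t) * (- (fps_X ^ k)) ^ t * 2 ^ (j - t)) =
          fps_const (real (j choose t) * (- 1) ^ t * 2 ^ (j - t)) * fps_X ^ (j + k * t)"
        by (simp add: fps_of_nat[symmetric] fps_const_mult[symmetric] power_add mult_ac
            del: fps_const_mult)
    qed
    finally have "(Y ^ j) $ E = (\<Sum>t\<le>j. if j + k * t = E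
        then real (j choose t) * (- 1) ^ t * 2 ^ (j - t) else 0)"
      by (simp add: fps_sum_nth fps_X_power_nth) (intro sum.cong refl, auto)
    then show "real (m + j choose j) * (Y ^ j) $ E = (\<Sum>t\<le>j. if j + k * t = E
        then real (m + j choose j) * (real (j choose t) * (- 1) ^ t * 2 ^ (j - t)) else 0)"
      by (auto simp: sum_distrib_left intro!: sum.cong)
  qed
  also have "\<dots> = (\<Sum>(j, t) \<in> (SIGMA j:{..E}. {..j}). if j + k * t = E
      then real (m + j choose j) * (real (j choose t) * (- 1) ^ t * 2 ^ (j - t)) else 0)"
    by (simp add: sum.Sigma)
  also have "\<dots> = (\<Sum>(j, t) \<in> {(j, t) \<in> (SIGMA j:{..E}. {..j}). j + k * t = E}.
      real (m + j choose j) * (real (j choose t) * (- 1) ^ t * 2 ^ (j - t)))"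
    by (rule sum.mono_neutral_cong_right) (auto split: if_splits)
  also have "\<dots> = (\<Sum>t \<in> {t. t \<le> T \<and> (k + 1) * t \<le> E}.
      (- 1) ^ t * 2 ^ (E - (k + 1) * t) *
        (real (m + (E - k * t) choose (E - k * t)) *
         real (E - k * t choose (E - (k + 1) * t))))"
  proof (rule sum.reindex_bij_witness[of _ "\<lambda>t. (E - k * t, t)" snd], goal_cases)
    case (1 p)
    then show ?case
      by auto
  next
    case (2 p)
    then obtain j t where p: "p = (j, t)" "t \<le> j" "j + k * t = E"
      by auto
    then have le: "(k + 1) * t \<le> E"
      by simp
    then have "t \<le> E div (k + 1)"
      by (simp add: less_eq_div_iff_mult_less_eq mult.commute)
    then show ?case
      using assms le p by simp
  next
    case (3 t)
    then show ?case
      by simp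
  next
    case (4 t)
    then show ?case
      by auto
  next
    case (5 p)
    then obtain j t where p: "p = (j, t)" "t \<le> j" "j + k * t = E"
      by auto
    then have j: "E - k * t = j" and jt: "E - (k + 1) * t = j - t"
      by auto
    show ?case
      using p binomial_symmetric[OF p(2)]
      unfolding p(1) snd_conv case_prod_conv j jt by simp
  qed
  also have "\<dots> = (\<Sum>t\<le>T. if (k + 1) * t \<le> E
      then (- 1) ^ t * 2 ^ (E - (k + 1) * t) *
        (real (m + (E - k * t) choose (E - k * t)) *
         real (E - k * t choose (E - (k + 1) * t)))
      else 0)"
    by (rule sum.mono_neutral_cong_left) auto
  finally show ?thesis .
qed

lemma int_binomial_of_nat: "int_binomial (int a) (int b) = (a choose b)"
  by (simp add: int_binomial_def binomial_eq_0)

text \<open>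
  With integer indices the guard \<open>(k + 1) * t \<le> E\<close> is absorbed by the vanishing of
  \<open>int_binomial\<close>. A negative \<open>c\<close> is included because \<open>c = e - 1\<close> is \<open>-1\<close> when \<open>e = 0\<close>.
\<close>

lemma nth_inverse_block_poly_power_int:
  assumes "c \<le> int E" and "E div (k + 1) \<le> T"
  shows "(if c < 0 then 0 else inverse (block_poly k ^ (m + 1)) $ nat c) =
    (\<Sum>t\<le>T. (- 1) ^ t * 2 powi (c - (int k + 1) * int t) *
      (real (int_binomial (int m + c - int k * int t) (c - int k * int t)) *
       real (int_binomial (c - int k * int t) (c - (int k + 1) * int t))))"
proof (cases "c < 0")
  case True
  have "\<not> 0 \<le> c - (int k + 1) * int t" for t
    using True by (smt (verit) mult_nonneg_nonneg of_nat_0_le_iff)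
  then have "int_binomial (c - int k * int t) (c - (int k + 1) * int t) = 0" for t
    unfolding int_binomial_def by simp
  then show ?thesis
    using True by simp
next
  case False
  define C where "C = nat c"
  have c: "c = int C"
    using False by (simp add: C_def)
  have "C div (k + 1) \<le> T"
    using assms c by (meson div_le_mono le_trans of_nat_le_iff)
  moreover have "(if (k + 1) * t \<le> C
      then (- 1) ^ t * 2 ^ (C - (k + 1) * t) *
        (real (m + (C - k * t) choose (C - k * t)) *
         real (C - k * t choose (C - (k + 1) * t)))
      else 0) =
    (- 1) ^ t * 2 powi (c - (int k + 1) * int t) *
      (real (int_binomial (int m + c - int k * int t) (c - int k * int t)) *
       real (int_binomial (c - int k * int t) (c - (int k + 1) * int t)))" for t
  proof (cases "(k + 1) * t \<le> C")
    case True
    then have "k * t \<le> C"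
      by simp
    then have eqs: "c - int k * int t = int (C - k * t)"
      "int m + c - int k * int t = int (m + (C - k * t))"
      unfolding c by (simp_all add: of_nat_diff)
    have eq: "c - (int k + 1) * int t = int (C - (k + 1) * t)"
      unfolding c of_nat_diff[OF True] by (simp add: algebra_simps)
    show ?thesis
      unfolding eqs eq by (simp only: int_binomial_of_nat power_int_of_nat True if_True)
  next
    case False
    then have "int C < int ((k + 1) * t)"
      by linarith
    then have "c - (int k + 1) * int t < 0"
      unfolding c by (simp add: algebra_simps)
    then show ?thesis
      using False by (simp add: int_binomial_def)
  qed
  ultimately show ?thesis
    using False nth_inverse_block_poly_power[of C k T m] by (simp add: C_def[symmetric])
qed

lemma w_ge_eq_coeff_diff:
  assumes "e = int n - (int m * int k + int m - 1)"
  shows "real (w_ge k n m) =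
    (if e < 0 then 0 else inverse (block_poly k ^ (m + 1)) $ nat e) -
    (if e - 1 < 0 then 0 else inverse (block_poly k ^ (m + 1)) $ nat (e - 1))"
proof -
  let ?D = "inverse (block_poly k ^ (m + 1))"
  have e: "e = int (Suc n) - int ((k + 1) * m)"
    using assms by (simp add: algebra_simps)
  have "real (w_ge k n m) = run_gf k m $ Suc n"
    by (simp add: run_gf_def)
  also have "\<dots> = (if Suc n < (k + 1) * m then 0 else ((1 - fps_X) * ?D) $ (Suc n - (k + 1) * m))"
    unfolding run_gf_closed fps_X_power_mult_nth ..
  also have "\<dots> = (if e < 0 then 0 else ((1 - fps_X) * ?D) $ nat e)"
  proof (cases "Suc n < (k + 1) * m")
    case True
    then have "e < 0"
      unfolding e by linarith
    with True show ?thesis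
      by simp
  next
    case False
    then have "e = int (Suc n - (k + 1) * m)"
      using e by (metis not_less of_nat_diff)
    then have "nat e = Suc n - (k + 1) * m" "\<not> e < 0"
      by simp_all
    then show ?thesis
      using False by (simp only: if_False)
  qed
  also have "\<dots> = (if e < 0 then 0 else ?D $ nat e - (if nat e = 0 then 0 else ?D $ (nat e - 1)))"
    by (simp only: left_diff_distrib mult_1_left fps_sub_nth fps_X_mult_nth)
  also have "\<dots> = (if e < 0 then 0 else ?D $ nat e) - (if e - 1 < 0 then 0 else ?D $ nat (e - 1))"
    by (auto simp: nat_diff_distrib)
  finally show ?thesis .
qed

theorem mainTheorem6:
  fixes n m k :: nat and e :: int
  assumes "n \<ge> 1" and "k \<le> n"
    and "e = int n - (int m * int k + int m - 1)"
  shows "real (w_ge k n m) =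
    (\<Sum>t = 0..\<lfloor>real_of_int e / real (k + 1)\<rfloor>.
       (- 1) powi t * 2 powi (e - (int k + 1) * t) *
       (real (int_binomial (int m + e - int k * t) (e - int k * t)) *
        real (int_binomial (e - int k * t) (e - (int k + 1) * t))
        - 1 / 2 *
          real (int_binomial (int m + e - 1 - int k * t) (e - 1 - int k * t)) *
          real (int_binomial (e - 1 - int k * t) (e - 1 - (int k + 1) * t))))"
proof -
  have floor: "\<lfloor>real_of_int e / real (k + 1)\<rfloor> = e div int (k + 1)"
    using floor_divide_of_int_eq[of e "int (k + 1)"] by simp
  show ?thesis
  proof (cases "e < 0")
    case True
    then have "e div int (k + 1) < 0"
      by (intro div_neg_pos_less0) simp_all
    then show ?thesis
      using w_ge_eq_coeff_diff[OF assms(3)] True unfolding floor by simp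
  next
    case False
    define E T where "E = nat e" and "T = E div (k + 1)"
    have e: "e = int E"
      using False by (simp add: E_def)
    have T: "e div int (k + 1) = int T"
      unfolding e T_def by (simp only: zdiv_int)
    let ?f = "\<lambda>c t. (- 1) ^ t * 2 powi (c - (int k + 1) * int t) *
      (real (int_binomial (int m + c - int k * int t) (c - int k * int t)) *
       real (int_binomial (c - int k * int t) (c - (int k + 1) * int t)))"
    have "real (w_ge k n m) = (\<Sum>t\<le>T. ?f e t) - (\<Sum>t\<le>T. ?f (e - 1) t)"
      unfolding w_ge_eq_coeff_diff[OF assms(3)]
      by (intro arg_cong2[of _ _ _ _ "(-)"] nth_inverse_block_poly_power_int[of _ E])
         (simp_all add: e T_def)
    also have "\<dots> = (\<Sum>t\<le>T. ?f e t - ?f (e - 1) t)"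
      by (simp only: sum_subtractf)
    also have "\<dots> = (\<Sum>t = 0..int T.
       (- 1) powi t * 2 powi (e - (int k + 1) * t) *
       (real (int_binomial (int m + e - int k * t) (e - int k * t)) *
        real (int_binomial (e - int k * t) (e - (int k + 1) * t))
        - 1 / 2 *
          real (int_binomial (int m + e - 1 - int k * t) (e - 1 - int k * t)) *
          real (int_binomial (e - 1 - int k * t) (e - 1 - (int k + 1) * t))))"
    proof (rule sum.reindex_bij_witness[of _ nat int], goal_cases)
      case (5 t)
      \<comment> \<open>the factor \<open>1/2\<close> comes from pulling the power of two at \<open>e\<close> out of the term at \<open>e - 1\<close>\<close>
      have "(2 :: real) powi (e - 1 - (int k + 1) * int t) =
          2 powi (e - (int k + 1) * int t) / 2"
        using power_int_diff[of "2 :: real" "e - (int k + 1) * int t" 1]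
        by (simp add: algebra_simps)
      moreover have "int m + (e - 1) = int m + e - 1"
        by simp
      ultimately show ?case
        by (simp add: algebra_simps)
    qed auto
    finally show ?thesis
      unfolding floor T .
  qed
qed

end
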